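(* Consider the optimisation problem in the variables $(a,u,v,u_K,v_{KK},w_\tau,s_{\mathrm{lo}},s_{\mathrm{hi}})\in\mathbb{R}^P\times\mathbb{R}^N\times\mathbb{R}^N\times(\mathbb{R}^G)^5$: minimise $$ \begin{aligned} &\tfrac12\|W^{1/2}(A^{q}a-y)\|_2^2+\tfrac{\mu}{2}(\|u\|_2^2+\|v\|_2^2)+\tfrac{\lambda_{\mathrm{ridge}}}{2}a^\top\Lambda a+\tfrac{\lambda_{\mathrm{DW}}}{2}a^\top E^\top L^{+}Ea+\tfrac{\eta_{\mathrm{RN}}}{2}(A_{\tau|K}a)^\top\Pi_{0^+}(A_{\tau|K}a)\\ &+\tfrac{\lambda_\Omega}{2}a^\top U_\omega^\top M_\omega^\top M_\omega U_\omega a+\tfrac{\lambda_{\mathrm{hook}}}{2}\|CAa\|_2^2+\tfrac{\lambda_{\mathrm{RN}}}{2}(Aa-C_{0^+})^\top\Pi_{0^+}(Aa-C_{0^+})\\ &+\tfrac{\lambda_{\mathrm{NA}}}{2}(\|u_K\|_2^2+\|v_{KK}\|_2^2+\|w_\tau\|_2^2)+\tfrac{\lambda_{\mathrm{B}}}{2}(\|s_{\mathrm{lo}}\|_2^2+\|s_{\mathrm{hi}}\|_2^2) \end{aligned} $$ subject to the componentwise constraints $u\ge p^{\mathrm{bid}}-A^{q}a$, $v\ge A^{q}a-p^{\mathrm{ask}}$, $u_K\ge A_Ka$, $v_{KK}\ge -A_{KK}a$, $w_\tau\ge -A_{\tau|K}a$, $s_{\mathrm{lo}}\ge -Aa$,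 $s_{\mathrm{hi}}\ge Aa-F$, and $u,v,u_K,v_{KK},w_\tau,s_{\mathrm{lo}},s_{\mathrm{hi}}\ge 0$, with $\mu,\lambda_{\mathrm{NA}},\lambda_{\mathrm B}>0$ and all other weights nonnegative. If the matrix $$ \begin{aligned} Q={}&(A^{q})^\top WA^{q}+\lambda_{\mathrm{ridge}}\Lambda+\lambda_{\mathrm{DW}}E^\top L^{+}E+\lambda_\Omega U_\omega^\top M_\omega^\top M_\omega U_\omega+\lambda_{\mathrm{hook}}A^\top C^\top CA\\ &+\lambda_{\mathrm{RN}}A^\top\Pi_{0^+}A+\eta_{\mathrm{RN}}A_{\tau|K}^\top\Pi_{0^+}A_{\tau|K} \end{aligned} $$ is positive definite, then the objective is strictly convex in all variables jointly and the minimiser is unique. In particular, it suffices that $(A^{q})^\top WA^{q}$ be positive definite on the span of $A^{q}$ (i.e. $a^\top (A^{q})^\top WA^{q}a>0$ whenever $A^{q}a\ne0$) and $\lambda_{\mathrm{ridge}}>0$.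
   Context: Coefficients $a=(a_{k\ell})_{0\le k\le K_0,\,0\le\ell\le L_0}\in\mathbb{R}^P$, $P=(K_0+1)(L_0+1)$, parametrise a surface $C_a(m,\tau)=\sum_{k,\ell}a_{k\ell}T_k(\Phi_m(m))T_\ell(\Phi_\tau(\tau))$, where $T_k$ are Chebyshev polynomials of the first kind and $\Phi_m,\Phi_\tau$ are fixed smooth coordinate maps into $[-1,1]$. All the following are fixed (independent of $a$). Quotes: $A^{q}\in\mathbb{R}^{N\times P}$ maps $a$ to the values of $C_a$ at $N$ quote points; $p^{\mathrm{bid}}\le p^{\mathrm{ask}}$ in $\mathbb{R}^N$ are bid and ask vectors, $y=\tfrac12(p^{\mathrm{bid}}+p^{\mathrm{ask}})$; $W=\mathrm{diag}(w_1,\dots,w_N)$ with $w_i>0$. Grid: on grid points $(m_g,\tau_g)$, $g=1,\dots,G$, with forwards $F=(F_g)$, $F_g>0$, and strikes $K_g=F_ge^{m_g}$, the matrices $A,A_m,A_{mm},A_\tau\in\mathbb{R}^{G\times P}$ map $a$ to the grid values of $C_a,\partial_mC_a,\partial_{mm}C_a,\partial_\tau C_a$; $A_K=\mathrm{diag}(K_g)^{-1}A_m$, $A_{KK}=\mathrm{diag}(K_g)^{-2}(A_{mm}-A_m)$, $A_{\tau|K}=A_\tau-\mathrm{diag}(\rho(\tau_g))A_m$ with $\rho=\frac{d}{d\tau}\log F$. Regularisers: $\Lambda\in\mathbb{R}^{P\times P}$ is diagonal with entries $(1+\alpha k^2+\beta\ell^2)^s$, $\alpha,\beta,s>0$; $E$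 is $A_{KK}$ with rows reordered by maturity slice; $L^{+}$ is a symmetric positive semidefinite matrix (pseudoinverse of a block-diagonal discrete Neumann Laplacian); $U_\omega\in\mathbb{R}^{P\times P}$ is orthogonal; $M_\omega\in\mathbb{R}^{P\times P}$ is a diagonal mask; $C=\widetilde A_{\tau|K}\widetilde A_K-\widetilde A_K\widetilde A_{\tau|K}$ for fixed $\widetilde A_K,\widetilde A_{\tau|K}\in\mathbb{R}^{G\times G}$; $\Pi_{0^+}\in\mathbb{R}^{G\times G}$ is the diagonal $0/1$ selector of grid points with $\tau_g\le\tau_\star$; $C_{0^+}\in\mathbb{R}^G$ is a fixed vector. *)

theory Defs
  imports "HOL-Analysis.Analysis"
begin

section \<open>General notions\<close>

fun chebyshev_T :: "nat \<Rightarrow> real \<Rightarrow> real" where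
  "chebyshev_T 0 x = 1"
| "chebyshev_T (Suc 0) x = x"
| "chebyshev_T (Suc (Suc n)) x = 2 * x * chebyshev_T (Suc n) x - chebyshev_T n x"

text \<open>A function on an arbitrary set is smooth if it is smooth on an open neighbourhood of the set;
  this admits closed coordinate ranges with the derivatives still given by \<^const>\<open>deriv\<close>.\<close>

definition smooth_on :: "(real \<Rightarrow> real) \<Rightarrow> real set \<Rightarrow> bool" where
  "smooth_on f D \<longleftrightarrow>
     (\<exists>U. open U \<and> D \<subseteq> U \<and> (\<forall>n. \<forall>x\<in>U. (deriv ^^ n) f differentiable (at x)))"

definition diagm :: "real ^ 'n \<Rightarrow> real ^ 'n ^ 'n" where
  "diagm v = (\<chi> i j. if i = j then v $ i else 0)"

definition diagonal_matrix :: "real ^ 'n ^ 'n \<Rightarrow> bool" where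
  "diagonal_matrix A \<longleftrightarrow> (\<forall>i j. i \<noteq> j \<longrightarrow> A $ i $ j = 0)"

definition pos_semidefinite :: "real ^ 'n ^ 'n \<Rightarrow> bool" where
  "pos_semidefinite A \<longleftrightarrow> transpose A = A \<and> (\<forall>x. 0 \<le> x \<bullet> (A *v x))"

definition pos_definite :: "real ^ 'n ^ 'n \<Rightarrow> bool" where
  "pos_definite A \<longleftrightarrow> transpose A = A \<and> (\<forall>x. x \<noteq> 0 \<longrightarrow> 0 < x \<bullet> (A *v x))"

definition strictly_convex_on :: "'a::real_vector set \<Rightarrow> ('a \<Rightarrow> real) \<Rightarrow> bool" where
  "strictly_convex_on S f \<longleftrightarrow> convex S \<and>
     (\<forall>x\<in>S. \<forall>y\<in>S. \<forall>t. x \<noteq> y \<longrightarrow> 0 < t \<longrightarrow> t < 1 \<longrightarrow>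
        f ((1 - t) *\<^sub>R x + t *\<^sub>R y) < (1 - t) * f x + t * f y)"

section \<open>Fixed data of the problem\<close>

text \<open>The index types are \<open>'p\<close> (coefficients), \<open>'n\<close> (quotes) and \<open>'g\<close> (grid points). The field
  \<open>cidx\<close> identifies a coefficient index with its pair of Chebyshev degrees \<open>(k, l)\<close>, which fixes
  \<open>CARD('p) = (K0 + 1) * (L0 + 1)\<close>. Row \<open>i\<close> of \<open>E\<close> is row \<open>rowperm i\<close> of \<open>A\<^bsub>KK\<^esub>\<close>, and \<open>rowno\<close> numbers the
  rows of \<open>E\<close> so that rows of the same maturity are consecutive. In \<open>Lplus\<close> any symmetric positive semidefinite
  matrix is allowed, whatever discretisation of the Neumann Laplacian it stems from.\<close>

record ('p::finite, 'n::finite, 'g::finite) calib =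
  K0 :: nat
  L0 :: nat
  cidx :: "'p \<Rightarrow> nat \<times> nat"
  mdom :: "real set"
  taudom :: "real set"
  Phi_m :: "real \<Rightarrow> real"
  Phi_tau :: "real \<Rightarrow> real"
  qm :: "'n \<Rightarrow> real"
  qtau :: "'n \<Rightarrow> real"
  pbid :: "real ^ 'n"
  pask :: "real ^ 'n"
  w :: "real ^ 'n"
  gm :: "'g \<Rightarrow> real"
  gtau :: "'g \<Rightarrow> real"
  fwd :: "real \<Rightarrow> real"
  alpha :: real
  beta :: real
  expo :: real
  rowno :: "'g \<Rightarrow> nat"
  rowperm :: "'g \<Rightarrow> 'g"
  Lplus :: "real ^ 'g ^ 'g"
  U_omega :: "real ^ 'p ^ 'p"
  M_omega :: "real ^ 'p ^ 'p"
  At_K :: "real ^ 'g ^ 'g"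
  At_tauK :: "real ^ 'g ^ 'g"
  tau_star :: real
  C0 :: "real ^ 'g"
  mu :: real
  lam_ridge :: real
  lam_DW :: real
  eta_RN :: real
  lam_Omega :: real
  lam_hook :: real
  lam_RN :: real
  lam_NA :: real
  lam_B :: real

definition valid_calib :: "('p::finite, 'n::finite, 'g::finite) calib \<Rightarrow> bool" where
  "valid_calib d \<longleftrightarrow>
     bij_betw (cidx d) UNIV ({0..K0 d} \<times> {0..L0 d}) \<and>
     smooth_on (Phi_m d) (mdom d) \<and> Phi_m d ` mdom d \<subseteq> {-1..1} \<and>
     smooth_on (Phi_tau d) (taudom d) \<and> Phi_tau d ` taudom d \<subseteq> {-1..1} \<and>
     (\<forall>i. qm d i \<in> mdom d \<and> qtau d i \<in> taudom d) \<and>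
     (\<forall>g. gm d g \<in> mdom d \<and> gtau d g \<in> taudom d) \<and>
     pbid d \<le> pask d \<and>
     (\<forall>i. 0 < w d $ i) \<and>
     (\<forall>t\<in>taudom d. 0 < fwd d t \<and> fwd d differentiable (at t)) \<and>
     0 < alpha d \<and> 0 < beta d \<and> 0 < expo d \<and>
     bij (rowperm d) \<and>
     bij_betw (rowno d) UNIV {0..<CARD('g)} \<and>
     (\<forall>i j k. rowno d i < rowno d j \<longrightarrow> rowno d j < rowno d k \<longrightarrow>
        gtau d (rowperm d i) = gtau d (rowperm d k) \<longrightarrow>
        gtau d (rowperm d j) = gtau d (rowperm d i)) \<and>
     pos_semidefinite (Lplus d) \<and>
     orthogonal_matrix (U_omega d) \<and>
     diagonal_matrix (M_omega d) \<and>
     0 < mu d \<and> 0 < lam_NA d \<and> 0 < lam_B d \<and>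
     0 \<le> lam_ridge d \<and> 0 \<le> lam_DW d \<and> 0 \<le> eta_RN d \<and>
     0 \<le> lam_Omega d \<and> 0 \<le> lam_hook d \<and> 0 \<le> lam_RN d"

definition surface ::
  "('p::finite, 'n::finite, 'g::finite) calib \<Rightarrow> real ^ 'p \<Rightarrow> real \<Rightarrow> real \<Rightarrow> real" where
  "surface d a m tau = (\<Sum>p\<in>UNIV. a $ p *
     chebyshev_T (fst (cidx d p)) (Phi_m d m) * chebyshev_T (snd (cidx d p)) (Phi_tau d tau))"

subsection \<open>Quotes\<close>

definition Aq :: "('p::finite, 'n::finite, 'g::finite) calib \<Rightarrow> real ^ 'p ^ 'n" where
  "Aq d = matrix (\<lambda>a. \<chi> i. surface d a (qm d i) (qtau d i))"

definition ymid :: "('p::finite, 'n::finite, 'g::finite) calib \<Rightarrow> real ^ 'n" where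
  "ymid d = (1/2) *\<^sub>R (pbid d + pask d)"

definition W :: "('p::finite, 'n::finite, 'g::finite) calib \<Rightarrow> real ^ 'n ^ 'n" where
  "W d = diagm (w d)"

definition Wsqrt :: "('p::finite, 'n::finite, 'g::finite) calib \<Rightarrow> real ^ 'n ^ 'n" where
  "Wsqrt d = diagm (\<chi> i. sqrt (w d $ i))"

subsection \<open>Grid\<close>

definition forwards :: "('p::finite, 'n::finite, 'g::finite) calib \<Rightarrow> real ^ 'g" where
  "forwards d = (\<chi> g. fwd d (gtau d g))"

definition strikes :: "('p::finite, 'n::finite, 'g::finite) calib \<Rightarrow> real ^ 'g" where
  "strikes d = (\<chi> g. forwards d $ g * exp (gm d g))"

definition rho :: "('p::finite, 'n::finite, 'g::finite) calib \<Rightarrow> real \<Rightarrow> real" where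
  "rho d = deriv (\<lambda>t. ln (fwd d t))"

definition A :: "('p::finite, 'n::finite, 'g::finite) calib \<Rightarrow> real ^ 'p ^ 'g" where
  "A d = matrix (\<lambda>a. \<chi> g. surface d a (gm d g) (gtau d g))"

definition A_m :: "('p::finite, 'n::finite, 'g::finite) calib \<Rightarrow> real ^ 'p ^ 'g" where
  "A_m d = matrix (\<lambda>a. \<chi> g. deriv (\<lambda>m. surface d a m (gtau d g)) (gm d g))"

definition A_mm :: "('p::finite, 'n::finite, 'g::finite) calib \<Rightarrow> real ^ 'p ^ 'g" where
  "A_mm d = matrix (\<lambda>a. \<chi> g. deriv (deriv (\<lambda>m. surface d a m (gtau d g))) (gm d g))"

definition A_tau :: "('p::finite, 'n::finite, 'g::finite) calib \<Rightarrow> real ^ 'p ^ 'g" where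
  "A_tau d = matrix (\<lambda>a. \<chi> g. deriv (\<lambda>tau. surface d a (gm d g) tau) (gtau d g))"

definition A_K :: "('p::finite, 'n::finite, 'g::finite) calib \<Rightarrow> real ^ 'p ^ 'g" where
  "A_K d = matrix_inv (diagm (strikes d)) ** A_m d"

definition A_KK :: "('p::finite, 'n::finite, 'g::finite) calib \<Rightarrow> real ^ 'p ^ 'g" where
  "A_KK d = matrix_inv (diagm (strikes d)) ** matrix_inv (diagm (strikes d)) ** (A_mm d - A_m d)"

definition A_tauK :: "('p::finite, 'n::finite, 'g::finite) calib \<Rightarrow> real ^ 'p ^ 'g" where
  "A_tauK d = A_tau d - diagm (\<chi> g. rho d (gtau d g)) ** A_m d"

text \<open>\<^term>\<open>matrix f\<close> represents \<open>f\<close> only if \<open>f\<close> is linear. For the five maps above this holds,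
  so the matrices do send \<open>a\<close> to the values of the surface and of its derivatives.\<close>

lemma chebyshev_T_poly: "\<exists>p. chebyshev_T n = poly p"
proof (induction n rule: less_induct)
  case (less n)
  consider "n = 0" | "n = Suc 0" | k where "n = Suc (Suc k)"
    by (metis not0_implies_Suc)
  then show ?case
  proof cases
    case 1
    have "chebyshev_T n = poly 1" using 1 by (auto simp: fun_eq_iff)
    then show ?thesis by blast
  next
    case 2
    have "chebyshev_T n = poly [:0,1:]" using 2 by (auto simp: fun_eq_iff)
    then show ?thesis by blast
  next
    case (3 k)
    from less[of "Suc k"] less[of k] 3 obtain p q
      where "chebyshev_T (Suc k) = poly p" "chebyshev_T k = poly q" by auto
    then have "chebyshev_T n = poly ([:0,2:] * p - q)" using 3 by (auto simp: fun_eq_iff)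
    then show ?thesis by blast
  qed
qed

lemma chebyshev_comp_deriv:
  assumes "smooth_on f D" "x \<in> D"
  shows "(\<lambda>x. chebyshev_T n (f x)) differentiable (at x)"
    and "\<forall>\<^sub>F y in nhds x. (\<lambda>x. chebyshev_T n (f x)) differentiable (at y)"
    and "deriv (\<lambda>x. chebyshev_T n (f x)) differentiable (at x)"
proof -
  obtain U where U: "open U" "D \<subseteq> U" and d: "\<And>n x. x \<in> U \<Longrightarrow> (deriv ^^ n) f differentiable (at x)"
    using assms by (auto simp: smooth_on_def)
  obtain p where p: "chebyshev_T n = poly p" using chebyshev_T_poly by blast
  have x: "x \<in> U" using assms U by auto
  have f1: "(f has_real_derivative deriv f y) (at y)" if "y \<in> U" for y
    using d[of y 0] that by (simp add: DERIV_deriv_iff_real_differentiable)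
  have f2: "deriv f differentiable (at y)" if "y \<in> U" for y
    using d[of y 1] that by simp
  have D: "((\<lambda>x. chebyshev_T n (f x)) has_real_derivative poly (pderiv p) (f y) * deriv f y) (at y)"
    if "y \<in> U" for y
    unfolding p by (rule DERIV_chain2[OF poly_DERIV f1[OF that]])
  show "(\<lambda>x. chebyshev_T n (f x)) differentiable (at x)"
    using D[OF x] real_differentiable_def by blast
  have evU: "\<forall>\<^sub>F y in nhds x. y \<in> U" using U x by (simp add: eventually_nhds_in_open)
  show "\<forall>\<^sub>F y in nhds x. (\<lambda>x. chebyshev_T n (f x)) differentiable (at y)"
    using evU by eventually_elim (use D real_differentiable_def in blast)
  have eq: "\<forall>\<^sub>F y in nhds x. deriv (\<lambda>x. chebyshev_T n (f x)) y = poly (pderiv p) (f y) * deriv f y"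
    using evU by eventually_elim (use D DERIV_imp_deriv in blast)
  have "((\<lambda>y. poly (pderiv p) (f y) * deriv f y) has_real_derivative
      (poly (pderiv (pderiv p)) (f x) * deriv f x) * deriv f x + deriv (deriv f) x * poly (pderiv p) (f x)) (at x)"
    by (rule DERIV_mult[OF DERIV_chain2[OF poly_DERIV f1[OF x]]])
       (use f2[OF x] in \<open>simp add: DERIV_deriv_iff_real_differentiable\<close>)
  then show "deriv (\<lambda>x. chebyshev_T n (f x)) differentiable (at x)"
    using DERIV_cong_ev[OF refl eq refl] real_differentiable_def by blast
qed

lemma deriv_lincomb:
  fixes b :: "'p::finite \<Rightarrow> real \<Rightarrow> real"
  assumes "\<And>p. b p differentiable (at x)"
  shows "deriv (\<lambda>x. \<Sum>p\<in>UNIV. a p * b p x) x = (\<Sum>p\<in>UNIV. a p * deriv (b p) x)"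
  by (rule DERIV_imp_deriv)
     (auto intro!: DERIV_sum DERIV_cmult simp: DERIV_deriv_iff_real_differentiable assms)

lemma matrix_mult_lincomb:
  fixes f :: "real^'p \<Rightarrow> real^'g"
  assumes "\<And>a g. f a $ g = (\<Sum>p\<in>UNIV. a $ p * c g p)"
  shows "matrix f *v a = f a"
proof -
  have "f (axis p 1) $ g = c g p" for p g
    unfolding assms axis_def by (simp add: if_distrib[where f="\<lambda>x. x * _"] cong: if_cong)
  then show ?thesis
    by (simp add: vec_eq_iff matrix_def matrix_vector_mult_def assms mult.commute)
qed

context
  fixes d :: "('p::finite, 'n::finite, 'g::finite) calib"
  assumes V: "valid_calib d"
begin

lemma calib_domains: "smooth_on (Phi_m d) (mdom d)" "smooth_on (Phi_tau d) (taudom d)"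
    "gm d g \<in> mdom d" "gtau d g \<in> taudom d"
  using V by (auto simp: valid_calib_def)

lemma surface_m: "surface d a m t = (\<Sum>p\<in>UNIV. (a $ p * chebyshev_T (snd (cidx d p)) (Phi_tau d t)) * chebyshev_T (fst (cidx d p)) (Phi_m d m))"
  by (simp add: surface_def mult_ac)

lemma Aq_mult: "Aq d *v a = (\<chi> i. surface d a (qm d i) (qtau d i))"
  unfolding Aq_def by (rule matrix_mult_lincomb) (simp add: surface_def mult.assoc)
lemma A_mult: "A d *v a = (\<chi> g. surface d a (gm d g) (gtau d g))"
  unfolding A_def by (rule matrix_mult_lincomb) (simp add: surface_def mult.assoc)
lemma A_m_mult: "A_m d *v a = (\<chi> g. deriv (\<lambda>m. surface d a m (gtau d g)) (gm d g))"
  unfolding A_m_def 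
  by (rule matrix_mult_lincomb) (subst vec_lambda_beta, subst surface_m, subst deriv_lincomb,
     rule chebyshev_comp_deriv(1)[OF calib_domains(1) calib_domains(3)], simp add: mult.assoc)
lemma A_tau_mult: "A_tau d *v a = (\<chi> g. deriv (\<lambda>t. surface d a (gm d g) t) (gtau d g))"
  unfolding A_tau_def surface_def
  by (rule matrix_mult_lincomb) (subst vec_lambda_beta, subst deriv_lincomb,
     rule chebyshev_comp_deriv(1)[OF calib_domains(2) calib_domains(4)], simp add: mult.assoc)
lemma A_mm_mult: "A_mm d *v a = (\<chi> g. deriv (deriv (\<lambda>m. surface d a m (gtau d g))) (gm d g))"
  unfolding A_mm_def
proof (rule matrix_mult_lincomb)
  fix a g
  let ?c = "\<lambda>p. a $ p * chebyshev_T (snd (cidx d p)) (Phi_tau d (gtau d g))"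
  let ?b = "\<lambda>p m. chebyshev_T (fst (cidx d p)) (Phi_m d m)"
  have "\<forall>\<^sub>F y in nhds (gm d g). \<forall>p\<in>UNIV. ?b p differentiable (at y)"
    by (intro eventually_ball_finite finite ballI chebyshev_comp_deriv(2)[OF calib_domains(1) calib_domains(3)])
  then have "\<forall>\<^sub>F y in nhds (gm d g). deriv (\<lambda>m. surface d a m (gtau d g)) y = (\<Sum>p\<in>UNIV. ?c p * deriv (?b p) y)"
    by eventually_elim (subst surface_m, rule deriv_lincomb, simp)
  then have "deriv (deriv (\<lambda>m. surface d a m (gtau d g))) (gm d g) = deriv (\<lambda>y. \<Sum>p\<in>UNIV. ?c p * deriv (?b p) y) (gm d g)"
    by (rule deriv_cong_ev) simp
  also have "\<dots> = (\<Sum>p\<in>UNIV. ?c p * deriv (deriv (?b p)) (gm d g))"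
    by (rule deriv_lincomb) (rule chebyshev_comp_deriv(3)[OF calib_domains(1) calib_domains(3)])
  finally show "(\<chi> g. deriv (deriv (\<lambda>m. surface d a m (gtau d g))) (gm d g)) $ g =
      (\<Sum>p\<in>UNIV. a $ p * (chebyshev_T (snd (cidx d p)) (Phi_tau d (gtau d g)) *
         deriv (deriv (\<lambda>m. chebyshev_T (fst (cidx d p)) (Phi_m d m))) (gm d g)))"
    by (simp add: mult.assoc)
qed
end

subsection \<open>Regularisers\<close>

definition Lambda :: "('p::finite, 'n::finite, 'g::finite) calib \<Rightarrow> real ^ 'p ^ 'p" where
  "Lambda d = diagm (\<chi> p. (1 + alpha d * (real (fst (cidx d p)))\<^sup>2
                             + beta d * (real (snd (cidx d p)))\<^sup>2) powr expo d)"

definition E :: "('p::finite, 'n::finite, 'g::finite) calib \<Rightarrow> real ^ 'p ^ 'g" where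
  "E d = (\<chi> i. A_KK d $ rowperm d i)"

definition C :: "('p::finite, 'n::finite, 'g::finite) calib \<Rightarrow> real ^ 'g ^ 'g" where
  "C d = At_tauK d ** At_K d - At_K d ** At_tauK d"

definition Pi0 :: "('p::finite, 'n::finite, 'g::finite) calib \<Rightarrow> real ^ 'g ^ 'g" where
  "Pi0 d = diagm (\<chi> g. if gtau d g \<le> tau_star d then 1 else 0)"

section \<open>The optimisation problem\<close>

type_synonym ('p, 'n, 'g) vars =
  "(real ^ 'p) \<times> (real ^ 'n) \<times> (real ^ 'n) \<times>
   (real ^ 'g) \<times> (real ^ 'g) \<times> (real ^ 'g) \<times> (real ^ 'g) \<times> (real ^ 'g)"

definition objective ::
  "('p::finite, 'n::finite, 'g::finite) calib \<Rightarrow> ('p, 'n, 'g) vars \<Rightarrow> real" where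
  "objective d = (\<lambda>(a, u, v, uK, vKK, wt, slo, shi).
     1/2 * (norm (Wsqrt d *v (Aq d *v a - ymid d)))\<^sup>2
     + mu d / 2 * ((norm u)\<^sup>2 + (norm v)\<^sup>2)
     + lam_ridge d / 2 * (a \<bullet> (Lambda d *v a))
     + lam_DW d / 2 * (a \<bullet> ((transpose (E d) ** Lplus d ** E d) *v a))
     + eta_RN d / 2 * ((A_tauK d *v a) \<bullet> (Pi0 d *v (A_tauK d *v a)))
     + lam_Omega d / 2 * (a \<bullet> ((transpose (U_omega d) ** transpose (M_omega d)
                                 ** M_omega d ** U_omega d) *v a))
     + lam_hook d / 2 * (norm ((C d ** A d) *v a))\<^sup>2
     + lam_RN d / 2 * ((A d *v a - C0 d) \<bullet> (Pi0 d *v (A d *v a - C0 d)))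
     + lam_NA d / 2 * ((norm uK)\<^sup>2 + (norm vKK)\<^sup>2 + (norm wt)\<^sup>2)
     + lam_B d / 2 * ((norm slo)\<^sup>2 + (norm shi)\<^sup>2))"

text \<open>The order on \<^typ>\<open>real ^ 'n\<close> is componentwise.\<close>

definition feasible ::
  "('p::finite, 'n::finite, 'g::finite) calib \<Rightarrow> ('p, 'n, 'g) vars set" where
  "feasible d = {(a, u, v, uK, vKK, wt, slo, shi).
     u \<ge> pbid d - Aq d *v a \<and> v \<ge> Aq d *v a - pask d \<and>
     uK \<ge> A_K d *v a \<and> vKK \<ge> - (A_KK d *v a) \<and> wt \<ge> - (A_tauK d *v a) \<and>
     slo \<ge> - (A d *v a) \<and> shi \<ge> A d *v a - forwards d \<and>
     u \<ge> 0 \<and> v \<ge> 0 \<and> uK \<ge> 0 \<and> vKK \<ge> 0 \<and> wt \<ge> 0 \<and> slo \<ge> 0 \<and> shi \<ge> 0}"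

definition Q :: "('p::finite, 'n::finite, 'g::finite) calib \<Rightarrow> real ^ 'p ^ 'p" where
  "Q d = transpose (Aq d) ** W d ** Aq d
     + lam_ridge d *\<^sub>R Lambda d
     + lam_DW d *\<^sub>R (transpose (E d) ** Lplus d ** E d)
     + lam_Omega d *\<^sub>R (transpose (U_omega d) ** transpose (M_omega d) ** M_omega d ** U_omega d)
     + lam_hook d *\<^sub>R (transpose (A d) ** transpose (C d) ** C d ** A d)
     + lam_RN d *\<^sub>R (transpose (A d) ** Pi0 d ** A d)
     + eta_RN d *\<^sub>R (transpose (A_tauK d) ** Pi0 d ** A_tauK d)"

end

theory Submission
  imports Defs
begin

text \<open>Up to an affine function the objective is half the quadratic form of the block-diagonal
  operator with blocks \<open>Q\<close> on \<open>a\<close> and \<open>mu\<close>, \<open>lam_NA\<close>, \<open>lam_B\<close> times the identity on the slack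
  variables. If \<open>Q\<close> is positive definite, so is this operator; the objective is then strictly
  convex and grows at least like a positive multiple of the squared norm, so it has exactly one
  minimiser on the closed, convex and nonempty feasible set.\<close>

section \<open>Quadratic functions with positive definite leading part\<close>

text \<open>Affine terms cancel in the convexity gap. What remains is exactly t (1 - t) / 2 times
  the form at \<open>x - y\<close>, which is positive for distinct points.\<close>

lemma strictly_convex_quadratic:
  fixes T :: "'a::real_inner \<Rightarrow> 'a"
  assumes T: "linear T" and pos: "\<And>z. z \<noteq> 0 \<Longrightarrow> 0 < z \<bullet> T z"
    and f: "\<And>z. f z = 1/2 * (z \<bullet> T z) - b \<bullet> z + c"
  shows "strictly_convex_on UNIV f"
  unfolding strictly_convex_on_def
proof (intro conjI ballI allI impI)
  fix x y :: 'a and t :: real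
  assume *: "x \<noteq> y" "0 < t" "t < 1"
  have "f ((1 - t) *\<^sub>R x + t *\<^sub>R y) =
      (1 - t) * f x + t * f y - t * (1 - t) / 2 * ((x - y) \<bullet> T (x - y))"
    unfolding f linear_add[OF T] linear_diff[OF T] linear_scale[OF T]
      inner_add_left inner_add_right inner_diff_left inner_diff_right
      inner_scaleR_left inner_scaleR_right
    by (simp add: field_simps)
  moreover have "0 < t * (1 - t) / 2 * ((x - y) \<bullet> T (x - y))"
    using * pos[of "x - y"] by simp
  ultimately show "f ((1 - t) *\<^sub>R x + t *\<^sub>R y) < (1 - t) * f x + t * f y"
    by linarith
qed simp

text \<open>Compactness of the unit sphere makes positivity uniform: \<open>k\<close> is the minimum
  of the form there, and homogeneity of degree two carries the bound to all
  \<open>z\<close>.\<close>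

lemma pos_definite_form_ge:
  fixes T :: "'a::euclidean_space \<Rightarrow> 'a"
  assumes T: "linear T" and pos: "\<And>z. z \<noteq> 0 \<Longrightarrow> 0 < z \<bullet> T z"
  obtains k where "0 < k" "\<And>z. k * (norm z)\<^sup>2 \<le> z \<bullet> T z"
proof -
  have cont: "continuous_on (sphere 0 1) (\<lambda>z. z \<bullet> T z)"
    using T by (intro continuous_intros linear_continuous_on) (simp add: linear_conv_bounded_linear)
  obtain z0 :: 'a where z0: "norm z0 = 1" "\<And>z. norm z = 1 \<Longrightarrow> z0 \<bullet> T z0 \<le> z \<bullet> T z"
    using continuous_attains_inf[OF compact_sphere _ cont] by auto
  have "z0 \<bullet> T z0 * (norm z)\<^sup>2 \<le> z \<bullet> T z" for z
  proof (cases "z = 0")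
    case False
    have "z0 \<bullet> T z0 \<le> (z /\<^sub>R norm z) \<bullet> T (z /\<^sub>R norm z)"
      using False by (intro z0) simp
    then show ?thesis
      using False by (simp add: linear_scale[OF T] field_simps power2_eq_square)
  qed (simp add: linear_0[OF T])
  moreover have "0 < z0 \<bullet> T z0"
    using z0(1) by (intro pos) auto
  ultimately show ?thesis using that by blast
qed

lemma quadratic_attains_min:
  fixes T :: "'a::euclidean_space \<Rightarrow> 'a"
  assumes T: "linear T" and pos: "\<And>z. z \<noteq> 0 \<Longrightarrow> 0 < z \<bullet> T z"
    and f: "\<And>z. f z = 1/2 * (z \<bullet> T z) - b \<bullet> z + c"
    and S: "closed S" "S \<noteq> {}"
  obtains x where "x \<in> S" "\<And>y. y \<in> S \<Longrightarrow> f x \<le> f y"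
proof -
  obtain k where k: "0 < k" "\<And>z. k * (norm z)\<^sup>2 \<le> z \<bullet> T z"
    using pos_definite_form_ge[OF T pos] by blast
  obtain s where s: "s \<in> S" using S by blast
  \<comment> \<open>The max with \<open>norm s\<close> keeps \<open>s\<close> in the ball. Beyond
    the second bound, half of the quadratic growth rate absorbs both \<open>norm b\<close> and the
    level of \<open>f s\<close>; the summand 1 ensures \<open>1 \<le> norm z\<close>.\<close>
  define R where "R = max (norm s) (2 / k * (norm b + \<bar>f s - c\<bar>) + 1)"
  have far: "f s \<le> f z" if "R < norm z" for z
  proof -
    have z: "1 \<le> norm z" "norm b + \<bar>f s - c\<bar> \<le> k / 2 * norm z"
    proof -
      have "2 / k * (norm b + \<bar>f s - c\<bar>) + 1 < norm z" using that by (simp add: R_def)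
      moreover have "0 \<le> 2 / k * (norm b + \<bar>f s - c\<bar>)" using k(1) by simp
      ultimately have "1 \<le> norm z" "2 / k * (norm b + \<bar>f s - c\<bar>) \<le> norm z" by linarith+
      then show "1 \<le> norm z" "norm b + \<bar>f s - c\<bar> \<le> k / 2 * norm z"
        using k(1) by (simp_all add: field_simps)
    qed
    \<comment> \<open>Since \<open>1 \<le> norm z\<close>, the constant may be multiplied by
      \<open>norm z\<close>, so that it can be compared with the quadratic and linear terms under
      one common factor.\<close>
    have "f s - c \<le> \<bar>f s - c\<bar> * norm z"
      using mult_left_mono[OF z(1), of "\<bar>f s - c\<bar>"] by simp
    also have "\<dots> \<le> (k / 2 * norm z - norm b) * norm z"
      using z by (intro mult_right_mono) auto
    also have "\<dots> = k * (norm z)\<^sup>2 / 2 - norm b * norm z"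
      by (simp add: algebra_simps power2_eq_square)
    also have "\<dots> \<le> 1/2 * (z \<bullet> T z) - b \<bullet> z"
      using k(2)[of z] norm_cauchy_schwarz[of b z] by simp
    finally show ?thesis by (simp add: f)
  qed
  have "continuous_on (S \<inter> cball 0 R) f"
    unfolding f using T
    by (intro continuous_intros linear_continuous_on) (simp add: linear_conv_bounded_linear)
  moreover have "compact (S \<inter> cball 0 R)" "s \<in> S \<inter> cball 0 R"
    using S s by (auto simp: closed_Int_compact R_def)
  ultimately obtain x where x: "x \<in> S" "\<And>y. y \<in> S \<inter> cball 0 R \<Longrightarrow> f x \<le> f y"
    using continuous_attains_inf[of "S \<inter> cball 0 R" f] by blast
  have "f x \<le> f y" if "y \<in> S" for y
  proof (cases "norm y \<le> R")
    case False
    then show ?thesis using far[of y] x(2)[OF \<open>s \<in> S \<inter> cball 0 R\<close>] by simp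
  qed (use x that in auto)
  then show ?thesis using x(1) that by blast
qed

text \<open>The midpoint of two distinct minimisers would lie in \<open>S\<close> and have a value
  strictly below their common minimum.\<close>

lemma strictly_convex_unique_min:
  assumes f: "strictly_convex_on UNIV f" and S: "convex S"
    and x: "is_arg_min f (\<lambda>z. z \<in> S) x" and y: "is_arg_min f (\<lambda>z. z \<in> S) y"
  shows "x = y"
proof (rule ccontr)
  let ?z = "(1 - 1/2) *\<^sub>R x + (1/2) *\<^sub>R y"
  assume "x \<noteq> y"
  then have "f ?z < (1 - 1/2) * f x + 1/2 * f y"
    using f[unfolded strictly_convex_on_def, THEN conjunct2, rule_format, of x y "1/2"] by simp
  moreover have "?z \<in> S"
    using x y by (intro convexD_alt[OF S]) (auto simp: is_arg_min_def)
  then have "f x \<le> f ?z" "f y \<le> f ?z"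
    using x y by (auto simp: is_arg_min_def not_less)
  ultimately show False by simp
qed

lemma quadratic_program:
  fixes T :: "'a::euclidean_space \<Rightarrow> 'a"
  assumes "linear T" "\<And>z. z \<noteq> 0 \<Longrightarrow> 0 < z \<bullet> T z"
    and "\<And>z. f z = 1/2 * (z \<bullet> T z) - b \<bullet> z + c"
    and "closed S" "convex S" "S \<noteq> {}"
  shows "strictly_convex_on UNIV f \<and> (\<exists>!z. is_arg_min f (\<lambda>z. z \<in> S) z)"
proof -
  have sc: "strictly_convex_on UNIV f"
    by (rule strictly_convex_quadratic[OF assms(1-3)])
  obtain x where "x \<in> S" "\<And>y. y \<in> S \<Longrightarrow> f x \<le> f y"
    using quadratic_attains_min[OF assms(1-4,6)] by blast
  then have "is_arg_min f (\<lambda>z. z \<in> S) x"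
    by (force simp: is_arg_min_def)
  with sc strictly_convex_unique_min[OF sc \<open>convex S\<close>] show ?thesis by blast
qed

section \<open>Diagonal matrices\<close>

lemma diagm_mult_nth: "(diagm v *v x) $ i = v $ i * x $ i"
  by (simp add: diagm_def matrix_vector_mult_def if_distrib[where f = "\<lambda>x. x * _"] cong: if_cong)

lemma transpose_diagm: "transpose (diagm v) = diagm v"
  by (auto simp: transpose_def diagm_def vec_eq_iff)

lemma inner_diagm_commute: "x \<bullet> (diagm v *v y) = (diagm v *v x) \<bullet> y"
  by (simp add: inner_vec_def diagm_mult_nth mult_ac)

text \<open>Expands a weighted least-squares residual; self-adjointness of a diagonal matrix merges
  the two cross terms into one.\<close>

lemma inner_diagm_diff:
  "(x - y) \<bullet> (diagm v *v (x - y)) =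
     x \<bullet> (diagm v *v x) - 2 * ((diagm v *v y) \<bullet> x) + y \<bullet> (diagm v *v y)"
  using inner_diagm_commute[of y v x]
  by (simp add: matrix_vector_mult_diff_distrib inner_diff_left inner_diff_right inner_commute)

lemma inner_diagm_nonneg: "(\<And>i. 0 \<le> v $ i) \<Longrightarrow> 0 \<le> x \<bullet> (diagm v *v x)"
  unfolding inner_vec_def diagm_mult_nth
  by (intro sum_nonneg) (simp add: mult.left_commute)

lemma inner_diagm_pos:
  assumes "\<And>i. 0 < v $ i" "x \<noteq> 0"
  shows "0 < x \<bullet> (diagm v *v x)"
proof -
  obtain i where i: "x $ i \<noteq> 0" using assms(2) by (auto simp: vec_eq_iff)
  have eq: "x $ j \<bullet> (v $ j * x $ j) = v $ j * (x $ j)\<^sup>2" for j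
    by (simp add: power2_eq_square)
  show ?thesis unfolding inner_vec_def diagm_mult_nth eq
    using i assms(1) by (intro sum_pos2[of _ i]) (auto simp: less_imp_le)
qed

section \<open>The quadratic form of the problem\<close>

lemma inner_transpose: "x \<bullet> (transpose B *v y) = (B *v x) \<bullet> y"
  for B :: "real ^ 'm ^ 'n"
  by (metis dot_lmul_matrix transpose_matrix_vector inner_commute)

lemma inner_transpose_mult: "x \<bullet> ((transpose B ** M ** B) *v y) = (B *v x) \<bullet> (M *v (B *v y))"
  for B :: "real ^ 'm ^ 'n"
  by (simp only: inner_transpose flip: matrix_vector_mul_assoc)

lemma inner_gram: "x \<bullet> ((transpose B ** transpose D ** D ** B) *v x) = (norm ((D ** B) *v x))\<^sup>2"
  for B :: "real ^ 'm ^ 'n" and D :: "real ^ 'n ^ 'k"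
  by (simp only: inner_transpose power2_norm_eq_inner flip: matrix_vector_mul_assoc)

lemma norm_Wsqrt:
  assumes "valid_calib d"
  shows "(norm (Wsqrt d *v x))\<^sup>2 = x \<bullet> (W d *v x)"
proof -
  have "0 < w d $ i" for i using assms by (simp add: valid_calib_def)
  then have "(sqrt (w d $ i) * r) * (sqrt (w d $ i) * r) = r * (w d $ i * r)" for i r
    by (simp add: power2_eq_square[symmetric] power_mult_distrib less_imp_le)
  then show ?thesis
    unfolding power2_norm_eq_inner inner_vec_def Wsqrt_def W_def diagm_mult_nth
    by (simp only: inner_real_def vec_lambda_beta)
qed

lemma inner_Q:
  "a \<bullet> (Q d *v a) = (Aq d *v a) \<bullet> (W d *v (Aq d *v a))
     + lam_ridge d * (a \<bullet> (Lambda d *v a))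
     + lam_DW d * (a \<bullet> ((transpose (E d) ** Lplus d ** E d) *v a))
     + lam_Omega d * (a \<bullet> ((transpose (U_omega d) ** transpose (M_omega d)
                                 ** M_omega d ** U_omega d) *v a))
     + lam_hook d * (norm ((C d ** A d) *v a))\<^sup>2
     + lam_RN d * ((A d *v a) \<bullet> (Pi0 d *v (A d *v a)))
     + eta_RN d * ((A_tauK d *v a) \<bullet> (Pi0 d *v (A_tauK d *v a)))"
  \<comment> \<open>The rules are instantiated at \<open>Aq d\<close>, \<open>A d\<close> and
    \<open>A_tauK d\<close> only, so the blocks with \<open>E\<close> and \<open>U_omega\<close>
    stay exactly as they occur in \<open>objective\<close>.\<close>
  by (simp only: Q_def matrix_vector_mult_add_rdistrib scaleR_matrix_vector_assoc[symmetric]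
      inner_add_right inner_scaleR_right inner_transpose_mult[of a "Aq d"]
      inner_transpose_mult[of a "A d"] inner_transpose_mult[of a "A_tauK d"] inner_gram[of a "A d"])

section \<open>Symmetry and positive definiteness of \<open>Q\<close>\<close>

lemma transpose_add: "transpose (X + Y) = transpose X + transpose Y"
  by (simp add: transpose_def vec_eq_iff)

lemma transpose_Q:
  assumes "valid_calib d"
  shows "transpose (Q d) = Q d"
proof -
  have "transpose (Lplus d) = Lplus d"
    using assms by (simp add: valid_calib_def pos_semidefinite_def)
  then show ?thesis
    by (simp add: Q_def transpose_add transpose_scalar matrix_transpose_mul matrix_mul_assoc
        W_def Lambda_def Pi0_def transpose_diagm)
qed

text \<open>The ridge block is strictly positive because \<open>Lambda\<close> has a positive
  diagonal, and every other block contributes a nonnegative amount.\<close>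

lemma pos_definite_Q:
  assumes V: "valid_calib d" and ridge: "0 < lam_ridge d"
  shows "pos_definite (Q d)"
  unfolding pos_definite_def
proof (intro conjI allI impI)
  fix a :: "real ^ 'a"
  assume a: "a \<noteq> 0"
  have nonneg: "0 \<le> lam_DW d" "0 \<le> eta_RN d" "0 \<le> lam_Omega d" "0 \<le> lam_hook d" "0 \<le> lam_RN d"
    "\<And>i. 0 \<le> w d $ i" and ab: "0 < alpha d" "0 < beta d" and L: "\<And>x. 0 \<le> x \<bullet> (Lplus d *v x)"
    using V by (auto simp: valid_calib_def pos_semidefinite_def less_imp_le)
  \<comment> \<open>These are the bases of the powers in \<open>Lambda\<close>; \<open>powr\<close>
    is positive as soon as its base is nonzero.\<close>
  have "0 < 1 + alpha d * (real m)\<^sup>2 + beta d * (real n)\<^sup>2" for m n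
    using ab by (intro add_pos_nonneg) auto
  then have "0 < a \<bullet> (Lambda d *v a)"
    unfolding Lambda_def using a by (intro inner_diagm_pos) (auto simp: less_imp_neq[THEN not_sym])
  moreover have "0 \<le> x \<bullet> (W d *v x)" for x
    unfolding W_def using nonneg by (intro inner_diagm_nonneg)
  moreover have "0 \<le> x \<bullet> (Pi0 d *v x)" for x
    unfolding Pi0_def by (intro inner_diagm_nonneg) simp
  ultimately show "0 < a \<bullet> (Q d *v a)"
    unfolding inner_Q inner_transpose_mult[of a "E d"] inner_gram[of a "U_omega d"]
    using nonneg L ridge by (intro add_pos_nonneg add_nonneg_pos) auto
qed (rule transpose_Q[OF V])

section \<open>The quadratic form in all variables jointly\<close>

definition hessian ::
  "('p::finite, 'n::finite, 'g::finite) calib \<Rightarrow> ('p, 'n, 'g) vars \<Rightarrow> ('p, 'n, 'g) vars" where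
  "hessian d = (\<lambda>(a, u, v, uK, vKK, wt, slo, shi).
     (Q d *v a, mu d *\<^sub>R u, mu d *\<^sub>R v, lam_NA d *\<^sub>R uK, lam_NA d *\<^sub>R vKK, lam_NA d *\<^sub>R wt,
      lam_B d *\<^sub>R slo, lam_B d *\<^sub>R shi))"

lemma linear_hessian: "linear (hessian d)"
  by (rule linearI)
     (auto simp: hessian_def matrix_vector_right_distrib matrix_vector_mult_scaleR scaleR_add_right)

text \<open>On the product type the inner product adds up the blocks, each nonnegative. The sum can
  vanish only if every block does, which forces \<open>z = 0\<close>.\<close>

lemma hessian_pos:
  assumes V: "valid_calib d" and Q: "pos_definite (Q d)" and z: "z \<noteq> 0"
  shows "0 < z \<bullet> hessian d z"
proof -
  obtain a u v uK vKK wt slo shi where z_eq: "z = (a, u, v, uK, vKK, wt, slo, shi)"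
    by (metis prod.exhaust)
  have pos: "0 < mu d" "0 < lam_NA d" "0 < lam_B d"
    using V by (auto simp: valid_calib_def)
  have Q0: "0 \<le> a \<bullet> (Q d *v a)" and Q1: "a \<noteq> 0 \<Longrightarrow> 0 < a \<bullet> (Q d *v a)"
    using Q by (cases "a = 0"; force simp: pos_definite_def)+
  have "0 \<le> z \<bullet> hessian d z"
    unfolding z_eq hessian_def using pos Q0 by (auto simp: inner_prod_def)
  moreover have "z \<bullet> hessian d z \<noteq> 0"
  proof
    assume "z \<bullet> hessian d z = 0"
    then have "a \<bullet> (Q d *v a) = 0" "u = 0" "v = 0" "uK = 0" "vKK = 0" "wt = 0" "slo = 0" "shi = 0"
      unfolding z_eq hessian_def using pos Q0
      by (auto simp: inner_prod_def add_nonneg_eq_0_iff)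
    with Q1 z show False by (auto simp: z_eq zero_prod_def)
  qed
  ultimately show ?thesis by linarith
qed

lemma objective_quadratic:
  assumes "valid_calib d"
  obtains b c where "\<And>z. objective d z = 1/2 * (z \<bullet> hessian d z) - b \<bullet> z + c"
proof -
  \<comment> \<open>Linear terms come only from the two fits with a target, \<open>ymid\<close> and
    \<open>C0\<close>. The slacks enter through pure squares, so their part of \<open>b\<close> is
    0.\<close>
  define b :: "('a, 'b, 'c) vars" where
    "b = (transpose (Aq d) *v (W d *v ymid d) + lam_RN d *\<^sub>R (transpose (A d) *v (Pi0 d *v C0 d)), 0)"
  define c where "c = 1/2 * (ymid d \<bullet> (W d *v ymid d)) + lam_RN d / 2 * (C0 d \<bullet> (Pi0 d *v C0 d))"
  have "objective d z = 1/2 * (z \<bullet> hessian d z) - b \<bullet> z + c" for z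
  proof -
    obtain a u v uK vKK wt slo shi where z: "z = (a, u, v, uK, vKK, wt, slo, shi)"
      by (metis prod.exhaust)
    have "b \<bullet> z = (W d *v ymid d) \<bullet> (Aq d *v a) + lam_RN d * ((Pi0 d *v C0 d) \<bullet> (A d *v a))"
      by (simp only: b_def z inner_Pair inner_add_right inner_scaleR_right inner_transpose
          inner_commute[of _ a]) (simp add: inner_commute)
    moreover have "z \<bullet> hessian d z = a \<bullet> (Q d *v a) + mu d * ((norm u)\<^sup>2 + (norm v)\<^sup>2)
        + lam_NA d * ((norm uK)\<^sup>2 + (norm vKK)\<^sup>2 + (norm wt)\<^sup>2)
        + lam_B d * ((norm slo)\<^sup>2 + (norm shi)\<^sup>2)"
      by (simp add: z hessian_def power2_norm_eq_inner algebra_simps)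
    moreover have
      "(Aq d *v a - ymid d) \<bullet> (W d *v (Aq d *v a - ymid d)) =
        (Aq d *v a) \<bullet> (W d *v (Aq d *v a)) - 2 * ((W d *v ymid d) \<bullet> (Aq d *v a))
          + ymid d \<bullet> (W d *v ymid d)"
      "(A d *v a - C0 d) \<bullet> (Pi0 d *v (A d *v a - C0 d)) =
        (A d *v a) \<bullet> (Pi0 d *v (A d *v a)) - 2 * ((Pi0 d *v C0 d) \<bullet> (A d *v a))
          + C0 d \<bullet> (Pi0 d *v C0 d)"
      unfolding W_def Pi0_def by (rule inner_diagm_diff)+
    ultimately show ?thesis
      unfolding objective_def z prod.case norm_Wsqrt[OF assms] c_def inner_Q
      by (simp only:) (simp add: field_simps)
  qed
  then show ?thesis using that by blast
qed

section \<open>The feasible set\<close>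

text \<open>Treats a whole block of componentwise constraints at once: the set is the preimage of a
  closed order interval, and the order is compatible with convex combinations.\<close>

lemma closed_convex_linear_ge:
  fixes L :: "'a::euclidean_space \<Rightarrow> 'b::ordered_euclidean_space"
  assumes "linear L"
  shows "closed {z. c \<le> L z} \<and> convex {z. c \<le> L z}"
proof
  have "closed (L -` {c..})"
    using assms
    by (intro closed_vimage linear_continuous_on) (auto simp: linear_conv_bounded_linear)
  then show "closed {z. c \<le> L z}" by (simp add: vimage_def)
  show "convex {z. c \<le> L z}"
  proof (rule convexI)
    fix x y and r t :: real
    assume "x \<in> {z. c \<le> L z}" "y \<in> {z. c \<le> L z}" and rt: "0 \<le> r" "0 \<le> t" "r + t = 1"
    then have "r *\<^sub>R c + t *\<^sub>R c \<le> r *\<^sub>R L x + t *\<^sub>R L y"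
      by (intro add_mono scaleR_left_mono) auto
    then show "r *\<^sub>R x + t *\<^sub>R y \<in> {z. c \<le> L z}"
      using rt by (simp add: linear_add[OF assms] linear_scale[OF assms] flip: scaleR_add_left)
  qed
qed

lemma closed_convex_Collect_conj:
  assumes "closed {z. P z} \<and> convex {z. P z}" "closed {z. R z} \<and> convex {z. R z}"
  shows "closed {z. P z \<and> R z} \<and> convex {z. P z \<and> R z}"
  using assms by (auto simp: Collect_conj_eq intro: convex_Int)

lemma feasible_closed_convex: "closed (feasible d) \<and> convex (feasible d)"
proof -
  \<comment> \<open>Each constraint is rearranged to bound a linear function of all variables from
    below by a constant.\<close>
  have eq: "feasible d = {(a, u, v, uK, vKK, wt, slo, shi).
      pbid d \<le> u + Aq d *v a \<and> - pask d \<le> v - Aq d *v a \<and>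
      0 \<le> uK - A_K d *v a \<and> 0 \<le> vKK + A_KK d *v a \<and> 0 \<le> wt + A_tauK d *v a \<and>
      0 \<le> slo + A d *v a \<and> - forwards d \<le> shi - A d *v a \<and>
      0 \<le> u \<and> 0 \<le> v \<and> 0 \<le> uK \<and> 0 \<le> vKK \<and> 0 \<le> wt \<and> 0 \<le> slo \<and> 0 \<le> shi}"
  proof -
    have "- x \<le> y \<longleftrightarrow> 0 \<le> y + x" for x y :: real by linarith
    then show ?thesis
      unfolding feasible_def by (simp add: algebra_simps less_eq_vec_def)
  qed
  show ?thesis
    unfolding eq case_prod_unfold
    by (intro closed_convex_Collect_conj closed_convex_linear_ge linearI)
       (simp_all add: matrix_vector_right_distrib matrix_vector_mult_scaleR algebra_simps)
qed

lemma feasible_nonempty: "feasible d \<noteq> {}"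
proof -
  \<comment> \<open>At \<open>a = 0\<close> the slacks must only dominate 0 and, respectively,
    \<open>pbid\<close>, \<open>- pask\<close> and \<open>- forwards\<close>; absolute values do
    both.\<close>
  have "(0, (\<chi> i. \<bar>pbid d $ i\<bar>), (\<chi> i. \<bar>pask d $ i\<bar>), 0, 0, 0, 0, (\<chi> g. \<bar>forwards d $ g\<bar>)) \<in> feasible d"
    by (auto simp: feasible_def less_eq_vec_def abs_le_iff)
  then show ?thesis by blast
qed

theorem proposition8:
  fixes d :: "('p::finite, 'n::finite, 'g::finite) calib"
  assumes "valid_calib d"
  shows "(pos_definite (Q d) \<longrightarrow>
            strictly_convex_on UNIV (objective d) \<and>
            (\<exists>!z. is_arg_min (objective d) (\<lambda>z. z \<in> feasible d) z)) \<and>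
         ((\<forall>a. Aq d *v a \<noteq> 0 \<longrightarrow> 0 < a \<bullet> ((transpose (Aq d) ** W d ** Aq d) *v a)) \<and>
          0 < lam_ridge d \<longrightarrow>
            pos_definite (Q d) \<and>
            strictly_convex_on UNIV (objective d) \<and>
            (\<exists>!z. is_arg_min (objective d) (\<lambda>z. z \<in> feasible d) z))"
proof -
  obtain b c where "\<And>z. objective d z = 1/2 * (z \<bullet> hessian d z) - b \<bullet> z + c"
    using objective_quadratic[OF assms] by blast
  then have "strictly_convex_on UNIV (objective d) \<and>
      (\<exists>!z. is_arg_min (objective d) (\<lambda>z. z \<in> feasible d) z)" if "pos_definite (Q d)"
    using feasible_closed_convex[of d] feasible_nonempty[of d]
    by (intro quadratic_program[OF linear_hessian hessian_pos[OF assms that]]) simp_all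
  \<comment> \<open>The second claim reduces to the first through positive definiteness of
    \<open>Q d\<close>.\<close>
  with pos_definite_Q[OF assms] show ?thesis by blast
qed

end
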